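(* Let $N$ be a positive integer. Then $$ \begin{aligned} &2N\zeta(2N+1)+4N\sum_{k=1}^{\infty}\frac{k^{-2N-1}}{e^{2\pi k}-1}+\left(1+(-1)^N\right)\pi\sum_{k=1}^{\infty}\frac{k^{-2N}}{\sinh^2(\pi k)}\\ &\qquad=(2\pi)^{2N+1}\sum_{j=0}^{N+1}(-1)^{j+1}(2j-1)\frac{B_{2j}}{(2j)!}\,\frac{B_{2N+2-2j}}{(2N+2-2j)!}. \end{aligned} $$
   Context: $\zeta$ denotes the Riemann zeta function. The Bernoulli numbers $B_k$ (so $B_0=1$, $B_1=-1/2$, $B_2=1/6$, etc.) are defined by $\dfrac{z}{e^z-1}=\sum_{k=0}^{\infty}\dfrac{B_k}{k!}z^k$ for $|z|<2\pi$. *)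

theory Defs
  imports "HOL-Complex_Analysis.Complex_Analysis"
begin

text \<open>
  The Dirichlet series, which is the Riemann zeta function on the half-plane of absolute
  convergence \<open>Re s > 1\<close> (or \<open>s > 1\<close> at type \<^typ>\<open>real\<close>). It is not continued analytically and
  carries no meaning for other arguments.
\<close>

definition zeta :: "'a::ln \<Rightarrow> 'a" where
  "zeta s = (\<Sum>n. of_nat (Suc n) powr (- s))"

text \<open>
  The value at \<open>z = 0\<close> is excluded because \<open>z / (exp z - 1)\<close> has a removable singularity there,
  which HOL would evaluate to \<open>0 / 0 = 0\<close> instead of \<open>1\<close>. The sequence is determined by the
  remaining values; see \<open>ex1_bernoulli\<close> below.
\<close>

definition is_bernoulli_seq :: "(nat \<Rightarrow> real) \<Rightarrow> bool" where
  "is_bernoulli_seq B \<longleftrightarrow>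
     (\<forall>z::complex. z \<noteq> 0 \<and> norm z < 2 * pi \<longrightarrow>
        (\<lambda>k. of_real (B k) / fact k * z ^ k) sums (z / (exp z - 1)))"

definition bernoulli :: "nat \<Rightarrow> real" where
  "bernoulli = (THE B. is_bernoulli_seq B)"

lemma powser_coeffs_unique:
  fixes a b :: "nat \<Rightarrow> complex"
  assumes r: "0 < r"
    and a: "\<And>z. z \<noteq> 0 \<Longrightarrow> norm z < r \<Longrightarrow> (\<lambda>n. a n * z ^ n) sums f z"
    and b: "\<And>z. z \<noteq> 0 \<Longrightarrow> norm z < r \<Longrightarrow> (\<lambda>n. b n * z ^ n) sums f z"
  shows "a = b"
proof -
  define c where "c = (\<lambda>n. a n - b n)"
  have c: "(\<lambda>n. c n * z ^ n) sums 0" if "z \<noteq> 0" "norm z < r" for z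
    using sums_diff[OF a[OF that] b[OF that]] by (simp add: c_def algebra_simps)
  have "((\<lambda>_::complex. 0) \<longlongrightarrow> c 0) (at 0)"
    using r c by (rule powser_limit_0_strong)
  then have c0: "c 0 = 0"
    using tendsto_unique[OF _ _ tendsto_const, of "at (0::complex)"] by fastforce
  have c': "(\<lambda>n. c n * (z - 0) ^ n) sums 0" if "norm (z - 0) < r" for z
    using c[of z] that c0 powser_sums_zero[of c] by (cases "z = 0") auto
  have "c m = 0" for m
  proof (rule ccontr)
    assume m: "c m \<noteq> 0"
    with c0 have "m > 0" by (cases m) auto
    obtain s where "0 < s" "\<And>z::complex. z \<in> cball 0 s - {0} \<Longrightarrow> (0::complex) \<noteq> 0"
      by (rule powser_0_nonzero[where a = c and f = "\<lambda>_. 0" and \<xi> = 0 and m = m, OF r c'])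
         (use m \<open>m > 0\<close> in auto)
    from this(1) this(2)[of "of_real s"] show False by auto
  qed
  then show ?thesis by (auto simp: c_def fun_eq_iff)
qed

lemma ex1_bernoulli: "\<exists>!B. is_bernoulli_seq B"
proof -
  define g :: "complex \<Rightarrow> complex" where "g = (\<lambda>z. if z = 0 then 1 else (exp z - 1) / z)"
  define f where "f = (\<lambda>z. 1 / g z)"
  have d: "deriv (\<lambda>z::complex. exp z - 1) 0 = 1"
    by (rule DERIV_imp_deriv) (auto intro!: derivative_eq_intros)
  have "g holomorphic_on ball 0 (2 * pi)"
    by (rule pole_theorem_open_0[where g = "\<lambda>z. exp z - 1" and a = 0])
       (auto simp: g_def d intro!: holomorphic_intros)
  moreover have "g z \<noteq> 0" if "z \<in> ball 0 (2 * pi)" for z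
  proof (cases "z = 0")
    case False
    have "exp z \<noteq> 1"
    proof
      assume "exp z = 1"
      then obtain n :: int where n: "Re z = 0" "Im z = of_int (2 * n) * pi"
        by (auto simp: exp_eq_1)
      with False have "n \<noteq> 0" by (auto simp: complex_eq_iff)
      then have "1 \<le> \<bar>real_of_int n\<bar>" by linarith
      then have "2 * pi \<le> \<bar>Im z\<bar>"
        by (auto simp: n abs_mult)
      also have "\<dots> \<le> norm z" by (rule abs_Im_le_cmod)
      finally show False using that by simp
    qed
    with False show ?thesis by (simp add: g_def)
  qed (simp add: g_def)
  ultimately have "f holomorphic_on ball 0 (2 * pi)"
    unfolding f_def by (intro holomorphic_intros)
  define c where "c = (\<lambda>n. (deriv ^^ n) f 0 / fact n)"
  have c: "(\<lambda>n. c n * z ^ n) sums (z / (exp z - 1))" if "z \<noteq> 0" "norm z < 2 * pi" for z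
    using holomorphic_power_series[OF \<open>f holomorphic_on _\<close>, of z] that
    by (simp add: c_def f_def g_def)
  have "(\<lambda>n. cnj (c n)) = c"
  proof (rule powser_coeffs_unique[where r = "2 * pi"])
    fix z :: complex assume z: "z \<noteq> 0" "norm z < 2 * pi"
    then show "(\<lambda>n. c n * z ^ n) sums (z / (exp z - 1))" by (rule c)
    have "(\<lambda>n. cnj (c n * cnj z ^ n)) sums cnj (cnj z / (exp (cnj z) - 1))"
      unfolding sums_cnj using c[of "cnj z"] z by simp
    then show "(\<lambda>n. cnj (c n) * z ^ n) sums (z / (exp z - 1))"
      by (simp add: exp_cnj)
  qed auto
  then have re: "of_real (Re (c n)) = c n" for n
    by (metis Reals_cnj_iff of_real_Re)
  define B where "B = (\<lambda>n. Re (c n) * fact n)"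
  have B: "of_real (B n) / fact n = c n" for n
    using re[of n] by (simp add: B_def)
  show ?thesis
  proof
    show "is_bernoulli_seq B"
      unfolding is_bernoulli_seq_def B using c by blast
  next
    fix B' assume B': "is_bernoulli_seq B'"
    have "(\<lambda>n. of_real (B' n) / fact n) = c"
      by (rule powser_coeffs_unique[where r = "2 * pi" and f = "\<lambda>z. z / (exp z - 1)"])
         (use B' c in \<open>auto simp: is_bernoulli_seq_def\<close>)
    then have "complex_of_real (B' n) / fact n = of_real (B n) / fact n" for n
      by (metis B)
    then show "B' = B" by (auto simp: fun_eq_iff)
  qed
qed

lemma bernoulli_sums:
  fixes z :: complex
  assumes "z \<noteq> 0" "norm z < 2 * pi"
  shows "(\<lambda>k. of_real (bernoulli k) / fact k * z ^ k) sums (z / (exp z - 1))"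
proof -
  have "is_bernoulli_seq bernoulli"
    unfolding bernoulli_def by (rule theI'[OF ex1_bernoulli])
  with assms show ?thesis by (simp add: is_bernoulli_seq_def)
qed

text \<open>
  Convergence of the infinite series, so that \<^const>\<open>suminf\<close> is not applied to divergent ones.
\<close>

lemma summable_zeta_real:
  fixes s :: real
  assumes "s > 1"
  shows "summable (\<lambda>n. of_nat (Suc n) powr (- s))"
proof -
  have "summable (\<lambda>n. of_nat n powr (- s))"
    unfolding summable_real_powr_iff using assms by simp
  then show ?thesis
    by (subst summable_Suc_iff[where f = "\<lambda>n. of_nat n powr (- s)"])
qed

lemma summable_exp_series:
  assumes "N > 0"
  shows "summable (\<lambda>k. (1 / real (Suc k) ^ (2 * N + 1)) / (exp (2 * pi * real (Suc k)) - 1))"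
proof (rule summable_comparison_test')
  show "summable (\<lambda>k. inverse (real (Suc k) ^ (2 * N + 1)))"
    using inverse_power_summable[of "2 * N + 1", where ?'a = real] assms
    by (subst summable_Suc_iff[where f = "\<lambda>k. inverse (real k ^ (2 * N + 1))"]) simp
  fix k :: nat
  define E where "E = exp (2 * pi * real (Suc k)) - 1"
  have "1 * 1 \<le> pi * real (Suc k)"
    by (rule mult_mono) (use pi_ge_two in auto)
  then have "1 \<le> E"
    using exp_ge_add_one_self[of "2 * pi * real (Suc k)"] unfolding E_def by linarith
  then have "inverse (real (Suc k) ^ (2 * N + 1)) / E \<le> inverse (real (Suc k) ^ (2 * N + 1)) / 1"
    by (intro divide_left_mono) auto
  then show "norm ((1 / real (Suc k) ^ (2 * N + 1)) / (exp (2 * pi * real (Suc k)) - 1))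
        \<le> inverse (real (Suc k) ^ (2 * N + 1))"
    using \<open>1 \<le> E\<close> unfolding E_def[symmetric] by (simp add: abs_mult inverse_eq_divide)
qed

lemma summable_sinh_series:
  assumes "N > 0"
  shows "summable (\<lambda>k. (1 / real (Suc k) ^ (2 * N)) / (sinh (pi * real (Suc k)))\<^sup>2)"
proof (rule summable_comparison_test')
  show "summable (\<lambda>k. inverse (real (Suc k) ^ (2 * N)))"
    using inverse_power_summable[of "2 * N", where ?'a = real] assms
    by (subst summable_Suc_iff[where f = "\<lambda>k. inverse (real k ^ (2 * N))"]) simp
  fix k :: nat
  define x where "x = pi * real (Suc k)"
  have "2 * 1 \<le> x"
    unfolding x_def by (rule mult_mono) (use pi_ge_two in auto)
  then have "3 \<le> exp x"
    using exp_ge_add_one_self[of x] by linarith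
  moreover have "exp (- x) \<le> 1"
    using \<open>2 * 1 \<le> x\<close> by simp
  ultimately have "(3 - 1) / 2 \<le> sinh x"
    unfolding sinh_field_def by (intro divide_right_mono diff_mono) auto
  then have "1 \<le> sinh x" by simp
  then have "1 \<le> (sinh x)\<^sup>2" by (rule one_le_power)
  then have "inverse (real (Suc k) ^ (2 * N)) / (sinh x)\<^sup>2 \<le> inverse (real (Suc k) ^ (2 * N)) / 1"
    by (intro divide_left_mono) auto
  then show "norm ((1 / real (Suc k) ^ (2 * N)) / (sinh (pi * real (Suc k)))\<^sup>2)
        \<le> inverse (real (Suc k) ^ (2 * N))"
    unfolding x_def[symmetric] by (simp add: abs_mult inverse_eq_divide)
qed

end

theory Submission
  imports Defs
begin

text \<open>
  Multiply the left-hand side by \<open>\<pi>\<close> and expand \<open>\<pi> coth (\<pi> k)\<close> and \<open>\<pi>\<^sup>2 / sinh\<^sup>2 (\<pi> k)\<close> into partial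
  fractions. Apart from a multiple of \<open>\<zeta>(2N + 2)\<close> this gives an absolutely convergent double series
  over \<open>k, m \<ge> 1\<close> of \<open>k\<^bsup>-2N\<^esup> (4N / (k\<^sup>2 + m\<^sup>2) + 2 (1 + (-1)\<^sup>N) (k\<^sup>2 - m\<^sup>2) / (k\<^sup>2 + m\<^sup>2)\<^sup>2)\<close>. Its sum does
  not change when the term is symmetrized in \<open>k\<close> and \<open>m\<close>, and the symmetrized term is a polynomial in
  \<open>u = 1 / k\<^sup>2\<close> and \<open>v = 1 / m\<^sup>2\<close>, because the denominators \<open>(u + v)\<^sup>2\<close> cancel. So the double series is a
  combination of products \<open>\<zeta>(2j) \<zeta>(2N + 2 - 2j)\<close>, which Euler's formula for \<open>\<zeta>(2j)\<close> turns into the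
  Bernoulli sum.
\<close>

section \<open>Partial fractions\<close>


lemma sin_pi_times_nonzero:
  fixes z :: complex
  assumes "z \<notin> \<int>"
  shows "sin (of_real pi * z) \<noteq> 0"
proof
  assume "sin (of_real pi * z) = 0"
  then obtain n :: int where "of_real pi * z = of_real (of_int n * pi)"
    by (auto simp: sin_eq_0)
  then have "z = of_int n" by simp
  with assms show False by simp
qed

text \<open>Differentiate the reflection formula
  \<open>rGamma z * rGamma (1 - z) = sin (pi * z) / pi\<close>. Since \<open>rGamma\<close> has
  logarithmic derivative \<open>- Digamma\<close>, the left side yields the product times the
  difference of digamma values; divide by that product.\<close>

lemma Digamma_reflection:
  fixes z :: complex
  assumes z: "z \<notin> \<int>"
  shows "Digamma (1 - z) - Digamma z = of_real pi * cot (of_real pi * z)"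
proof -
  have z1: "1 - z \<notin> \<int>"
    using z by (metis Ints_1 Ints_diff diff_diff_eq2 add_diff_cancel_left')
  then have [simp]: "z \<notin> \<int>\<^sub>\<le>\<^sub>0" "1 - z \<notin> \<int>\<^sub>\<le>\<^sub>0"
    using z nonpos_Ints_subset_Ints by auto
  have D1: "((\<lambda>z. rGamma z * rGamma (1 - z)) has_field_derivative
      rGamma z * rGamma (1 - z) * (Digamma (1 - z) - Digamma z)) (at z)"
    by (rule derivative_eq_intros refl DERIV_chain'[where g = rGamma]
          has_field_derivative_rGamma_no_nonpos_int | simp add: algebra_simps)+
  have D2: "((\<lambda>z. rGamma z * rGamma (1 - z)) has_field_derivative cos (of_real pi * z)) (at z)"
    unfolding rGamma_reflection_complex
    by (auto intro!: derivative_eq_intros)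
  have "sin (of_real pi * z) / of_real pi * (Digamma (1 - z) - Digamma z) = cos (of_real pi * z)"
    using DERIV_unique[OF D1 D2] unfolding rGamma_reflection_complex .
  then show ?thesis
    using sin_pi_times_nonzero[OF z] by (simp add: cot_def field_simps)
qed

text \<open>This is the derivative of \<open>Digamma_reflection\<close>, with both signs
  reversed.\<close>

lemma trigamma_reflection:
  fixes z :: complex
  assumes z: "z \<notin> \<int>"
  shows "Polygamma 1 (1 - z) + Polygamma 1 z = (of_real pi)\<^sup>2 / (sin (of_real pi * z))\<^sup>2"
proof -
  have z1: "1 - z \<notin> \<int>"
    using z by (metis Ints_1 Ints_diff diff_diff_eq2 add_diff_cancel_left')
  then have [simp]: "z \<notin> \<int>\<^sub>\<le>\<^sub>0" "1 - z \<notin> \<int>\<^sub>\<le>\<^sub>0"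
    using z nonpos_Ints_subset_Ints by auto
  \<comment> \<open>The digamma formula can be differentiated only once it holds on a whole
    neighbourhood of \<open>z\<close>, which openness of the non-integers provides.\<close>
  have "open (- \<int> :: complex set)"
    using closed_Ints by (simp add: open_Compl)
  then have ev: "\<forall>\<^sub>F w in nhds z. w \<in> - \<int>"
    by (rule eventually_nhds_in_open) (use z in auto)
  have D1: "((\<lambda>z. Digamma (1 - z) - Digamma z) has_field_derivative
      - Polygamma 1 (1 - z) - Polygamma 1 z) (at z)"
    by (rule derivative_eq_intros refl DERIV_chain'[where g = Digamma] | simp)+
  moreover have "\<forall>\<^sub>F w in nhds z. Digamma (1 - w) - Digamma w = of_real pi * cot (of_real pi * w)"
    using ev by eventually_elim (simp add: Digamma_reflection)
  ultimately have "((\<lambda>w. of_real pi * cot (of_real pi * w)) has_field_derivative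
      - Polygamma 1 (1 - z) - Polygamma 1 z) (at z)"
    by (subst (asm) DERIV_cong_ev[OF refl _ refl]) auto
  moreover have "((\<lambda>w. of_real pi * cot (of_real pi * w)) has_field_derivative
      of_real pi * (- inverse ((sin (of_real pi * z))\<^sup>2) * (of_real pi * 1))) (at z)"
    by (intro DERIV_cmult DERIV_chain2[OF DERIV_cot] DERIV_ident sin_pi_times_nonzero z)
  ultimately have "- Polygamma 1 (1 - z) - Polygamma 1 z
      = of_real pi * (- inverse ((sin (of_real pi * z))\<^sup>2) * (of_real pi * 1))"
    by (rule DERIV_unique)
  also have "\<dots> = - ((of_real pi)\<^sup>2 / (sin (of_real pi * z))\<^sup>2)"
    by (simp add: power2_eq_square divide_inverse)
  finally have "- (- Polygamma 1 (1 - z) - Polygamma 1 z)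
      = - (- ((of_real pi)\<^sup>2 / (sin (of_real pi * z))\<^sup>2))"
    by (rule arg_cong)
  then show ?thesis by (simp add: add.commute)
qed

section \<open>Partial fractions of the cotangent and of the inverse squared sine\<close>

lemma not_Ints_plus_of_nat:
  fixes z :: complex
  assumes "z \<notin> \<int>"
  shows "z + of_nat n \<noteq> 0" "z - of_nat n \<noteq> 0"
  using assms by (auto simp: add_eq_0_iff2)

text \<open>In the limit formula for \<open>Digamma\<close>, the logarithms cancel in
  \<open>Digamma (1 - z) - Digamma (1 + z)\<close>, which leaves a series. Reflection and the shift
  \<open>Digamma (1 + z) = Digamma z + 1 / z\<close> give its value.\<close>

lemma cot_partial_fractions:
  fixes z :: complex
  assumes z: "z \<notin> \<int>"
  shows "(\<lambda>n. 2 * z / (z\<^sup>2 - of_nat (Suc n) ^ 2)) sums (of_real pi * cot (of_real pi * z) - 1 / z)"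
proof -
  have nz: "z \<noteq> 0" "1 - z \<noteq> 0" "1 + z \<noteq> 0"
    using not_Ints_plus_of_nat[OF z, of 0] not_Ints_plus_of_nat[OF z, of 1]
    by (auto simp: add.commute)
  have "(\<lambda>m. (of_real (ln (real m)) - (\<Sum>n<m. inverse (1 - z + of_nat n)))
           - (of_real (ln (real m)) - (\<Sum>n<m. inverse (1 + z + of_nat n))))
         \<longlonglongrightarrow> Digamma (1 - z) - Digamma (1 + z)"
    using nz by (intro tendsto_diff Digamma_LIMSEQ)
  then have "(\<lambda>n. inverse (1 + z + of_nat n) - inverse (1 - z + of_nat n))
        sums (Digamma (1 - z) - Digamma (1 + z))"
    by (simp add: sums_def sum_subtractf)
  also have "Digamma (1 - z) - Digamma (1 + z) = of_real pi * cot (of_real pi * z) - 1 / z"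
    using Digamma_plus1[OF nz(1)] Digamma_reflection[OF z] by (simp add: add.commute)
  also have "(\<lambda>n. inverse (1 + z + of_nat n) - inverse (1 - z + of_nat n))
      = (\<lambda>n. 2 * z / (z\<^sup>2 - of_nat (Suc n) ^ 2))"
  proof
    fix n
    have "inverse (1 + z + of_nat n) - inverse (1 - z + of_nat n)
       = inverse (z + of_nat (Suc n)) + inverse (z - of_nat (Suc n))"
    proof -
      have "1 - z + of_nat n = - (z - of_nat (Suc n))" "1 + z + of_nat n = z + of_nat (Suc n)"
        by simp_all
      then show ?thesis by (simp only: inverse_minus_eq diff_minus_eq_add)
    qed
    also have "\<dots> = 2 * z / ((z + of_nat (Suc n)) * (z - of_nat (Suc n)))"
      using not_Ints_plus_of_nat[OF z, of "Suc n"] 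
      by (simp add: divide_simps del: of_nat_Suc)
    finally show "inverse (1 + z + of_nat n) - inverse (1 - z + of_nat n) 
       = 2 * z / (z\<^sup>2 - of_nat (Suc n) ^ 2)"
      by (simp add: power2_eq_square algebra_simps)
  qed
  finally show ?thesis .
qed

text \<open>Add the trigamma series at \<open>1 - z\<close> and \<open>1 + z\<close>. The shift from
  \<open>1 + z\<close> to \<open>z\<close> produces the term \<open>- 1 / z^2\<close>, and
  reflection evaluates the rest.\<close>

lemma inverse_sin_squared_partial_fractions:
  fixes z :: complex
  assumes z: "z \<notin> \<int>"
  shows "(\<lambda>n. 2 * (z\<^sup>2 + of_nat (Suc n) ^ 2) / (z\<^sup>2 - of_nat (Suc n) ^ 2)\<^sup>2)
     sums ((of_real pi)\<^sup>2 / (sin (of_real pi * z))\<^sup>2 - 1 / z\<^sup>2)"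
proof -
  have nz: "z \<noteq> 0" "1 - z \<noteq> 0" "1 + z \<noteq> 0"
    using not_Ints_plus_of_nat[OF z, of 0] not_Ints_plus_of_nat[OF z, of 1]
    by (auto simp: add.commute)
  have "(\<lambda>n. inverse ((1 - z + of_nat n)\<^sup>2) + inverse ((1 + z + of_nat n)\<^sup>2))
        sums (Polygamma 1 (1 - z) + Polygamma 1 (1 + z))"
    using sums_add[OF Polygamma_LIMSEQ[OF nz(2), of 1] Polygamma_LIMSEQ[OF nz(3), of 1]]
    by (simp add: power2_eq_square)
  also have "Polygamma 1 (1 - z) + Polygamma 1 (1 + z) =
      (of_real pi)\<^sup>2 / (sin (of_real pi * z))\<^sup>2 - 1 / z\<^sup>2"
    using Polygamma_plus1[OF nz(1), of 1] trigamma_reflection[OF z]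
    by (simp add: add.commute power2_eq_square)
  also have "(\<lambda>n. inverse ((1 - z + of_nat n)\<^sup>2) + inverse ((1 + z + of_nat n)\<^sup>2))
      = (\<lambda>n. 2 * (z\<^sup>2 + of_nat (Suc n) ^ 2) / (z\<^sup>2 - of_nat (Suc n) ^ 2)\<^sup>2)"
  proof
    fix n
    define m :: complex where "m = of_nat (Suc n)"
    have m: "z + m \<noteq> 0" "z - m \<noteq> 0"
      using not_Ints_plus_of_nat[OF z, of "Suc n"] by (simp_all add: m_def)
    have "inverse ((1 - z + of_nat n)\<^sup>2) + inverse ((1 + z + of_nat n)\<^sup>2) =
      inverse ((z - m)\<^sup>2) + inverse ((z + m)\<^sup>2)"
      by (simp add: m_def power2_commute[of z] algebra_simps)
    also have "\<dots> = ((z + m)\<^sup>2 + (z - m)\<^sup>2) / ((z + m) * (z - m))\<^sup>2"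
      using m by (simp add: divide_simps power_mult_distrib)
    also have "\<dots> = 2 * (z\<^sup>2 + m\<^sup>2) / (z\<^sup>2 - m\<^sup>2)\<^sup>2"
      by (simp add: power2_eq_square algebra_simps)
    finally show "inverse ((1 - z + of_nat n)\<^sup>2) + inverse ((1 + z + of_nat n)\<^sup>2)
       = 2 * (z\<^sup>2 + of_nat (Suc n) ^ 2) / (z\<^sup>2 - of_nat (Suc n) ^ 2)\<^sup>2"
      by (simp only: m_def)
  qed
  finally show ?thesis .
qed

section \<open>Passage to hyperbolic functions along the imaginary axis\<close>

lemma ii_times_real_not_Ints:
  assumes "x \<noteq> 0"
  shows "\<i> * of_real x \<notin> \<int>"
proof
  assume "\<i> * of_real x \<in> \<int>"
  then have "Im (\<i> * of_real x) = 0" by (auto elim: Ints_cases simp del: Im_i_times)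
  with assms show False by simp
qed

lemma sinh_complex_of_real: "sinh (complex_of_real x) = of_real (sinh x)"
  by (simp add: sinh_field_def flip: exp_of_real)

lemma cosh_complex_of_real: "cosh (complex_of_real x) = of_real (cosh x)"
  by (simp add: cosh_field_def flip: exp_of_real)

text \<open>Put \<open>z = \<i> * x\<close> in the cotangent expansion and multiply by
  \<open>\<i>\<close>: the denominators \<open>z^2 - n^2\<close> become \<open>-(x^2 + n^2)\<close>,
  and all terms become real.\<close>

lemma coth_partial_fractions:
  fixes x :: real
  assumes x: "x \<noteq> 0"
  shows "(\<lambda>n. 2 * x / (x\<^sup>2 + real (Suc n) ^ 2)) sums (pi * (cosh (pi * x) / sinh (pi * x)) - 1 / x)"
proof -
  define z where "z = \<i> * of_real x"
  have pz: "of_real pi * z = \<i> * of_real (pi * x)" by (simp add: z_def)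
  have cot: "cot (of_real pi * z) = - \<i> * of_real (cosh (pi * x) / sinh (pi * x))"
    unfolding cot_def pz sin_conv_sinh cos_conv_cosh
    by (simp add: sinh_complex_of_real cosh_complex_of_real divide_inverse
          flip: mult.assoc of_real_mult) simp
  have "(\<lambda>n. \<i> * (2 * z / (z\<^sup>2 - of_nat (Suc n) ^ 2)))
      sums (\<i> * (of_real pi * cot (of_real pi * z) - 1 / z))"
    unfolding z_def by (intro sums_mult cot_partial_fractions ii_times_real_not_Ints x)
  also have "\<i> * (of_real pi * cot (of_real pi * z) - 1 / z)
     = of_real (pi * (cosh (pi * x) / sinh (pi * x)) - 1 / x)"
    unfolding cot using x by (simp add: z_def algebra_simps)
  also have "(\<lambda>n. \<i> * (2 * z / (z\<^sup>2 - of_nat (Suc n) ^ 2)))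
     = (\<lambda>n. of_real (2 * x / (x\<^sup>2 + real (Suc n) ^ 2)))"
  proof
    fix n
    define m where "m = real (Suc n)"
    define s where "s = x\<^sup>2 + m\<^sup>2"
    have "s \<noteq> 0" using x by (simp add: s_def sum_power2_eq_zero_iff)
    moreover have "z\<^sup>2 - of_nat (Suc n) ^ 2 = - of_real s"
      by (simp add: z_def m_def s_def power_mult_distrib)
    moreover have "\<i> * (2 * z) = - of_real (2 * x)"
      by (simp add: z_def algebra_simps)
    ultimately show "\<i> * (2 * z / (z\<^sup>2 - of_nat (Suc n) ^ 2)) = of_real (2 * x / (x\<^sup>2 + real (Suc n) ^ 2))"
      unfolding m_def[symmetric] s_def[symmetric]
      by (simp only: times_divide_eq_right of_real_divide) simp
  qed
  finally show ?thesis by (simp only: sums_of_real_iff)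
qed

text \<open>The substitution \<open>z = \<i> * x\<close> again. The overall minus sign compensates
  for \<open>sin^2\<close> turning into \<open>- sinh^2\<close>.\<close>

lemma inverse_sinh_squared_partial_fractions:
  fixes x :: real
  assumes x: "x \<noteq> 0"
  shows "(\<lambda>n. 2 * (x\<^sup>2 - real (Suc n) ^ 2) / (x\<^sup>2 + real (Suc n) ^ 2)\<^sup>2)
    sums (pi\<^sup>2 / (sinh (pi * x))\<^sup>2 - 1 / x\<^sup>2)"
proof -
  define z where "z = \<i> * of_real x"
  have pz: "of_real pi * z = \<i> * of_real (pi * x)" by (simp add: z_def)
  have sin: "(sin (of_real pi * z))\<^sup>2 = - of_real ((sinh (pi * x))\<^sup>2)"
    unfolding pz sin_conv_sinh
    by (simp add: power_mult_distrib sinh_complex_of_real flip: mult.assoc of_real_mult)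
  have "(\<lambda>n. - (2 * (z\<^sup>2 + of_nat (Suc n) ^ 2) / (z\<^sup>2 - of_nat (Suc n) ^ 2)\<^sup>2))
      sums (- ((of_real pi)\<^sup>2 / (sin (of_real pi * z))\<^sup>2 - 1 / z\<^sup>2))"
    unfolding z_def by (intro sums_minus inverse_sin_squared_partial_fractions ii_times_real_not_Ints x)
  also have "- ((of_real pi)\<^sup>2 / (sin (of_real pi * z))\<^sup>2 - 1 / z\<^sup>2)
     = of_real (pi\<^sup>2 / (sinh (pi * x))\<^sup>2 - 1 / x\<^sup>2)"
    unfolding sin by (simp add: z_def power_mult_distrib)
  also have "(\<lambda>n. - (2 * (z\<^sup>2 + of_nat (Suc n) ^ 2) / (z\<^sup>2 - of_nat (Suc n) ^ 2)\<^sup>2))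
     = (\<lambda>n. of_real (2 * (x\<^sup>2 - real (Suc n) ^ 2) / (x\<^sup>2 + real (Suc n) ^ 2)\<^sup>2))"
  proof
    fix n
    define m where "m = real (Suc n)"
    have "z\<^sup>2 - of_nat (Suc n) ^ 2 = - of_real (x\<^sup>2 + m\<^sup>2)"
      by (simp add: z_def m_def power_mult_distrib)
    moreover have "z\<^sup>2 + of_nat (Suc n) ^ 2 = - of_real (x\<^sup>2 - m\<^sup>2)"
      by (simp add: z_def m_def power_mult_distrib)
    ultimately show "- (2 * (z\<^sup>2 + of_nat (Suc n) ^ 2) / (z\<^sup>2 - of_nat (Suc n) ^ 2)\<^sup>2)
        = of_real (2 * (x\<^sup>2 - real (Suc n) ^ 2) / (x\<^sup>2 + real (Suc n) ^ 2)\<^sup>2)"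
      unfolding m_def[symmetric] by (simp only: power2_minus of_real_divide of_real_mult of_real_power of_real_numeral
            mult_minus_right minus_divide_left minus_minus)
  qed
  finally show ?thesis by (simp only: sums_of_real_iff)
qed

section \<open>Zeta values at even integers\<close>


lemma zeta_of_nat_sums:
  assumes "n \<ge> 2"
  shows "(\<lambda>k. 1 / real (Suc k) ^ n) sums zeta (real n)"
proof -
  have "(\<lambda>k. real (Suc k) powr - real n) sums zeta (real n)"
    unfolding zeta_def using summable_zeta_real[of "real n"] assms by (intro summable_sums) simp
  also have "(\<lambda>k. real (Suc k) powr - real n) = (\<lambda>k. 1 / real (Suc k) ^ n)"
    by (simp add: powr_minus powr_realpow inverse_eq_divide)
  finally show ?thesis .
qed

lemma geometric_has_sum_Suc:
  fixes w :: "'a :: {real_normed_field, banach}"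
  assumes "norm w < 1"
  shows "((\<lambda>j. w ^ Suc j) has_sum w / (1 - w)) UNIV"
proof (rule norm_summable_imp_has_sum)
  show "summable (\<lambda>j. norm (w ^ Suc j))"
    using assms by (subst summable_Suc_iff) (simp add: norm_power summable_geometric)
  show "(\<lambda>j. w ^ Suc j) sums (w / (1 - w))"
    using sums_mult[OF geometric_sums[OF assms], of w] by simp
qed

lemma not_Ints_if_norm_less_1:
  fixes x :: complex
  assumes x: "x \<noteq> 0" "norm x < 1"
  shows "x \<notin> \<int>"
proof
  assume "x \<in> \<int>"
  then obtain n :: int where n: "x = of_int n" by (auto elim: Ints_cases)
  with x have "n \<noteq> 0" by auto
  then have "1 \<le> \<bar>n\<bar>" by linarith
  then have "1 \<le> norm x" unfolding n norm_of_int by linarith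
  with x show False by simp
qed

text \<open>Expand each partial fraction of the cotangent as a geometric series in
  \<open>(x / m)^2\<close>. Summing the resulting double series over the exponent first gives the
  cotangent, and summing over \<open>m\<close> first gives the zeta values.\<close>

lemma cot_power_series:
  fixes x :: complex
  assumes x: "x \<noteq> 0" "norm x < 1"
  shows "(\<lambda>j. of_real (zeta (real (2 * j + 2))) * x ^ (2 * j + 2)) sums
     ((1 - of_real pi * x * cot (of_real pi * x)) / 2)"
proof -
  define F :: "nat \<times> nat \<Rightarrow> complex" where "F = (\<lambda>(m, j). ((x / of_nat (Suc m))\<^sup>2) ^ Suc j)"
  have nx: "(norm x)\<^sup>2 < 1"
    using x by (simp add: power_less_one_iff)
  have w: "(norm x / real (Suc m))\<^sup>2 \<le> (norm x)\<^sup>2" for m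
    by (intro power_mono) (auto simp: field_simps)
  have norm_w: "norm ((x / of_nat (Suc m))\<^sup>2) = (norm x / real (Suc m))\<^sup>2" for m
    by (simp add: norm_power norm_divide del: of_nat_Suc)
  have w1: "norm ((x / of_nat (Suc m))\<^sup>2) < 1" for m
    using w[of m] nx by (simp only: norm_w)
  \<comment> \<open>Every ratio is at most \<open>(norm x)^2 < 1\<close> in norm, so the geometric
    sum for \<open>m\<close> is dominated by a constant times \<open>1 / m^2\<close>.\<close>
  have "(\<lambda>p. norm (F p)) summable_on UNIV \<times> UNIV"
  proof (rule summable_on_SigmaI)
    fix m :: nat
    show "((\<lambda>j. norm (F (m, j))) has_sum ((norm x / real (Suc m))\<^sup>2 / (1 - (norm x / real (Suc m))\<^sup>2))) UNIV"
      using geometric_has_sum_Suc[of "(norm x / real (Suc m))\<^sup>2"] w[of m] nx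
      unfolding F_def by (simp add: norm_power norm_divide del: of_nat_Suc power_Suc)
  next
    have "(\<lambda>m. (norm x)\<^sup>2 / (1 - (norm x)\<^sup>2) * (1 / real (Suc m) ^ 2)) summable_on UNIV"
      using zeta_of_nat_sums[of 2] nx
      by (intro summable_nonneg_imp_summable_on summable_mult) (auto simp: sums_iff)
    then show "(\<lambda>m. (norm x / real (Suc m))\<^sup>2 / (1 - (norm x / real (Suc m))\<^sup>2)) summable_on UNIV"
    proof (rule summable_on_comparison_test)
      fix m :: nat
      have "0 < 1 - (norm x / real (Suc m))\<^sup>2" "0 < 1 - (norm x)\<^sup>2"
        using w[of m] nx by linarith+
      then have "(norm x / real (Suc m))\<^sup>2 / (1 - (norm x / real (Suc m))\<^sup>2)
         \<le> (norm x / real (Suc m))\<^sup>2 / (1 - (norm x)\<^sup>2)"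
        using w[of m] by (intro divide_left_mono mult_pos_pos zero_le_power2) linarith+
      then show "(norm x / real (Suc m))\<^sup>2 / (1 - (norm x / real (Suc m))\<^sup>2)
         \<le> (norm x)\<^sup>2 / (1 - (norm x)\<^sup>2) * (1 / real (Suc m) ^ 2)"
        by (simp add: power_divide mult.commute del: of_nat_Suc)
      show "0 \<le> (norm x / real (Suc m))\<^sup>2 / (1 - (norm x / real (Suc m))\<^sup>2)"
        using w[of m] nx by (intro divide_nonneg_nonneg zero_le_power2) linarith
    qed
  qed auto
  then have "F summable_on UNIV \<times> UNIV"
    by (rule abs_summable_summable)
  then obtain S where S: "(F has_sum S) (UNIV \<times> UNIV)"
    by (auto simp: summable_on_def)
  have "x \<notin> \<int>"
    using x by (rule not_Ints_if_norm_less_1)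
  have row: "(x / of_nat (Suc m))\<^sup>2 / (1 - (x / of_nat (Suc m))\<^sup>2) =
      - (x / 2) * (2 * x / (x\<^sup>2 - of_nat (Suc m) ^ 2))" for m
  proof -
    define q :: complex where "q = of_nat (Suc m)"
    have "q \<noteq> 0" by (simp add: q_def del: of_nat_Suc)
    moreover have "x\<^sup>2 - q\<^sup>2 \<noteq> 0"
    proof
      assume "x\<^sup>2 - q\<^sup>2 = 0"
      then have "(x / q)\<^sup>2 = 1" using \<open>q \<noteq> 0\<close> by (simp add: power_divide)
      with w1[of m] show False by (simp add: q_def)
    qed
    ultimately have "(x / q)\<^sup>2 / (1 - (x / q)\<^sup>2) = - (x / 2) * (2 * x / (x\<^sup>2 - q\<^sup>2))"
      by (simp add: power_divide divide_simps) (simp add: algebra_simps power2_eq_square)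
    then show ?thesis by (simp only: q_def)
  qed
  \<comment> \<open>First order of summation: over the exponents, with \<open>m\<close>
    fixed.\<close>
  have "((\<lambda>m. (x / of_nat (Suc m))\<^sup>2 / (1 - (x / of_nat (Suc m))\<^sup>2)) has_sum S) UNIV"
    using S by (rule has_sum_SigmaD)
      (use geometric_has_sum_Suc[OF w1] in \<open>simp add: F_def del: of_nat_Suc power_Suc\<close>)
  then have "(\<lambda>m. - (x / 2) * (2 * x / (x\<^sup>2 - of_nat (Suc m) ^ 2))) sums S"
    unfolding row by (rule has_sum_imp_sums)
  moreover have "(\<lambda>m. - (x / 2) * (2 * x / (x\<^sup>2 - of_nat (Suc m) ^ 2))) sums
      (- (x / 2) * (of_real pi * cot (of_real pi * x) - 1 / x))"
    by (intro sums_mult cot_partial_fractions \<open>x \<notin> \<int>\<close>)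
  ultimately have "S = - (x / 2) * (of_real pi * cot (of_real pi * x) - 1 / x)"
    by (rule sums_unique2)
  also have "\<dots> = (1 - of_real pi * x * cot (of_real pi * x)) / 2"
    using x by (simp add: field_simps)
  finally have S_eq: "S = (1 - of_real pi * x * cot (of_real pi * x)) / 2" .
  \<comment> \<open>Second order of summation: over \<open>m\<close>, with the exponent
    fixed.\<close>
  have "((\<lambda>j. of_real (zeta (real (2 * j + 2))) * x ^ (2 * j + 2)) has_sum S) UNIV"
  proof (rule has_sum_SigmaD)
    show "((\<lambda>(j, m). F (m, j)) has_sum S) (UNIV \<times> UNIV)"
      using S has_sum_swap by blast
  next
    fix j :: nat
    have "((\<lambda>m. 1 / real (Suc m) ^ (2 * j + 2)) has_sum zeta (real (2 * j + 2))) UNIV"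
      by (intro sums_nonneg_imp_has_sum zeta_of_nat_sums) auto
    then have "((\<lambda>m. x ^ (2 * j + 2) * of_real (1 / real (Suc m) ^ (2 * j + 2)))
        has_sum x ^ (2 * j + 2) * of_real (zeta (real (2 * j + 2)))) UNIV"
      by (intro has_sum_cmult_right has_sum_of_real)
    moreover have "F (m, j) = x ^ (2 * j + 2) * of_real (1 / real (Suc m) ^ (2 * j + 2))" for m
    proof -
      have "F (m, j) = (x / of_nat (Suc m)) ^ (2 * Suc j)"
        unfolding F_def prod.case power_mult ..
      then show ?thesis by (simp add: power_divide del: of_nat_Suc power_Suc)
    qed
    ultimately show "((\<lambda>m. case (j, m) of (j, m) \<Rightarrow> F (m, j)) has_sum
        of_real (zeta (real (2 * j + 2))) * x ^ (2 * j + 2)) UNIV"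
      by (simp add: mult.commute)
  qed
  then show ?thesis unfolding S_eq by (rule has_sum_imp_sums)
qed

section \<open>Bernoulli numbers and Euler's formula\<close>

text \<open>With \<open>E = exp (\<i> * pi * x)\<close>, both \<open>exp z = E^2\<close> and the
  cotangent \<open>\<i> * (E^2 + 1) / (E^2 - 1)\<close> are rational in \<open>E\<close>. Now use
  \<open>(E^2 + 1) / (E^2 - 1) = 1 + 2 / (E^2 - 1)\<close>.\<close>

lemma bernoulli_generating_function_cot:
  fixes x :: complex
  assumes "sin (of_real pi * x) \<noteq> 0"
  defines "z \<equiv> 2 * of_real pi * \<i> * x"
  shows "z / (exp z - 1) = of_real pi * x * cot (of_real pi * x) - of_real pi * \<i> * x"
proof -
  define E where "E = exp (\<i> * (of_real pi * x))"
  have E0: "E \<noteq> 0" by (simp add: E_def)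
  have "exp z = E ^ 2"
    by (simp add: E_def z_def flip: exp_of_nat_mult) (simp add: algebra_simps)
  have s: "sin (of_real pi * x) = (E - 1 / E) / (2 * \<i>)"
    by (simp add: sin_exp_eq E_def exp_minus inverse_eq_divide)
  have c: "cos (of_real pi * x) = (E + 1 / E) / 2"
    by (simp add: cos_exp_eq E_def exp_minus inverse_eq_divide)
  have E1: "E\<^sup>2 - 1 \<noteq> 0"
    using assms(1) E0 unfolding s by (auto simp: field_simps power2_eq_square)
  have "cot (of_real pi * x) = \<i> * (E\<^sup>2 + 1) / (E\<^sup>2 - 1)"
  proof -
    have "E - 1 / E = (E\<^sup>2 - 1) / E" "E + 1 / E = (E\<^sup>2 + 1) / E"
      using E0 by (simp_all add: field_simps power2_eq_square)
    then show ?thesis unfolding cot_def s c using E0 E1 by (simp add: field_simps)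
  qed
  then show ?thesis
    unfolding \<open>exp z = E ^ 2\<close> using E1 by (simp add: z_def divide_simps) (simp add: algebra_simps)
qed

text \<open>Under \<open>z = 2 * pi * \<i> * x\<close>, the disc \<open>norm z < 2 * pi\<close>
  becomes \<open>norm x < 1\<close>. There \<open>z / (exp z - 1)\<close> has two power series in
  \<open>x\<close>, the defining one and the one obtained from the cotangent, so their coefficients
  agree.\<close>

lemma bernoulli_eq_zeta:
  "complex_of_real (bernoulli n) / fact n * (2 * of_real pi * \<i>) ^ n =
    (if n = 0 then 1 else if n = 1 then - of_real pi * \<i>
     else if even n then - 2 * of_real (zeta (real n)) else 0)"
proof -
  define a where "a = (\<lambda>n. of_real (bernoulli n) / fact n * (2 * of_real pi * \<i>) ^ n)"
  define c :: "nat \<Rightarrow> complex" where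
    "c = (\<lambda>n. if even n \<and> n \<noteq> 0 then - 2 * of_real (zeta (real n)) else 0)"
  define b where "b = (\<lambda>n. c n + (if n = 0 then 1 else 0) + (if n = 1 then - of_real pi * \<i> else 0))"
  define g where "g = (\<lambda>x. of_real pi * x * cot (of_real pi * x) - of_real pi * \<i> * x)"
  have "a = b"
  proof (rule powser_coeffs_unique)
    fix x :: complex assume x: "x \<noteq> 0" "norm x < 1"
    define z where "z = 2 * of_real pi * \<i> * x"
    have "x \<notin> \<int>"
      using x by (rule not_Ints_if_norm_less_1)
    then have "z / (exp z - 1) = g x"
      unfolding z_def g_def by (intro bernoulli_generating_function_cot sin_pi_times_nonzero)
    moreover have "z \<noteq> 0" "norm z < 2 * pi"
      using x by (auto simp: z_def norm_mult)
    ultimately have "(\<lambda>n. of_real (bernoulli n) / fact n * z ^ n) sums g x"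
      using bernoulli_sums by metis
    then show "(\<lambda>n. a n * x ^ n) sums g x"
      by (simp add: a_def z_def power_mult_distrib mult_ac)
    have "(\<lambda>j. - 2 * (of_real (zeta (real (2 * j + 2))) * x ^ (2 * j + 2))) sums
        (- 2 * ((1 - of_real pi * x * cot (of_real pi * x)) / 2))"
      by (intro sums_mult cot_power_series x)
    also have "- 2 * ((1 - of_real pi * x * cot (of_real pi * x)) / 2)
        = of_real pi * x * cot (of_real pi * x) - 1"
      by simp
    finally have "(\<lambda>j. c (2 * j + 2) * x ^ (2 * j + 2)) sums (of_real pi * x * cot (of_real pi * x) - 1)"
      by (simp add: c_def mult_ac)
    moreover have "strict_mono (\<lambda>j::nat. 2 * j + 2)"
      by (auto simp: strict_mono_def)
    moreover have "c n * x ^ n = 0" if "n \<notin> range (\<lambda>j::nat. 2 * j + 2)" for n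
    proof -
      have "\<not> (even n \<and> n \<noteq> 0)"
      proof
        assume "even n \<and> n \<noteq> 0"
        then obtain i where "n = 2 * Suc i" by (metis evenE mult_0_right not0_implies_Suc)
        with that show False by auto
      qed
      then show ?thesis by (auto simp: c_def)
    qed
    \<comment> \<open>The cotangent series runs over the exponents \<open>2 * j + 2\<close> only;
      filling in zero coefficients turns it into a full power series.\<close>
    ultimately have C: "(\<lambda>n. c n * x ^ n) sums (of_real pi * x * cot (of_real pi * x) - 1)"
      using sums_mono_reindex[of "\<lambda>j. 2 * j + 2" "\<lambda>n. c n * x ^ n"] by simp
    have "(\<lambda>n. c n * x ^ n + (if n = 0 then x ^ n else 0) + (if n = 1 then - of_real pi * \<i> * x ^ n else 0))
       sums (of_real pi * x * cot (of_real pi * x) - 1 + x ^ 0 + (- of_real pi * \<i> * x ^ 1))"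
      by (intro sums_add C sums_single)
    moreover have "(\<lambda>n. c n * x ^ n + (if n = 0 then x ^ n else 0) + (if n = 1 then - of_real pi * \<i> * x ^ n else 0))
       = (\<lambda>n. b n * x ^ n)"
      by (auto simp: b_def fun_eq_iff algebra_simps)
    ultimately show "(\<lambda>n. b n * x ^ n) sums g x"
      by (simp add: g_def)
  qed auto
  then have "a n = b n" by simp
  then show ?thesis by (auto simp: a_def b_def c_def)
qed

lemma bernoulli_0: "bernoulli 0 = 1"
  using bernoulli_eq_zeta[of 0] by simp

text \<open>Euler's formula, read off from \<open>bernoulli_eq_zeta\<close> at an even index. The
  power of \<open>\<i>\<close> there is the sign \<open>e = (-1)^j\<close>, which is its own inverse
  and so moves to the other side.\<close>

lemma bernoulli_even_eq_zeta:
  assumes j: "j > 0"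
  shows "bernoulli (2 * j) / fact (2 * j) = 2 * (- 1) ^ (j + 1) * zeta (real (2 * j)) / (2 * pi) ^ (2 * j)"
proof -
  define p where "p = (2 * pi) ^ (2 * j)"
  define b where "b = bernoulli (2 * j) / fact (2 * j)"
  define e :: real where "e = (- 1) ^ j"
  have p: "p \<noteq> 0" by (simp add: p_def)
  have ee: "e * e = 1" by (simp add: e_def flip: power_mult_distrib)
  have "(2 * of_real pi * \<i>) ^ (2 * j) = complex_of_real (e * p)"
    by (simp add: e_def p_def power_mult power_mult_distrib
          power_minus[of "4 * (complex_of_real pi)\<^sup>2"])
  then have "complex_of_real (b * (e * p)) = of_real (- 2 * zeta (real (2 * j)))"
    using bernoulli_eq_zeta[of "2 * j"] j by (simp add: b_def)
  then have "b * (e * p) = - 2 * zeta (real (2 * j))"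
    by (simp only: of_real_eq_iff)
  then have "e * (b * (e * p)) = e * (- 2 * zeta (real (2 * j)))" by (rule arg_cong)
  then have "(e * e) * (b * p) = - 2 * e * zeta (real (2 * j))" by (simp only: mult_ac)
  then have "b = - 2 * e * zeta (real (2 * j)) / p" using p ee by (simp add: field_simps)
  then show ?thesis by (simp add: b_def p_def e_def)
qed

section \<open>The double series\<close>


text \<open>This is a geometric sum in \<open>- u / v\<close> with linear weights, so its closed
  form has denominator \<open>(u + v)^2\<close>, cleared here. In the induction, raising
  \<open>N\<close> by one multiplies the old terms by \<open>v\<close> and appends the term
  \<open>j = N + 1\<close>.\<close>

lemma alternating_odd_weighted_sum_closed_form:
  fixes u v :: "'a :: comm_ring_1"
  shows "(u + v)\<^sup>2 * (\<Sum>j = 1..N. (- 1) ^ j * (2 * of_nat j - 1) * u ^ j * v ^ (N + 1 - j)) =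
    u\<^sup>2 * v ^ (N + 1) - u * v ^ (N + 2)
    + (- 1) ^ N * ((2 * of_nat N + 1) * u ^ (N + 1) * v\<^sup>2 + (2 * of_nat N - 1) * u ^ (N + 2) * v)"
proof (induction N)
  case 0
  then show ?case by (simp add: power2_eq_square algebra_simps)
next
  case (Suc N)
  have "(\<Sum>j = 1..Suc N. (- 1) ^ j * (2 * of_nat j - 1) * u ^ j * v ^ (Suc N + 1 - j))
     = v * (\<Sum>j = 1..N. (- 1) ^ j * (2 * of_nat j - 1) * u ^ j * v ^ (N + 1 - j))
       + (- 1) ^ Suc N * (2 * of_nat (Suc N) - 1) * u ^ Suc N * v"
    by (simp add: sum_distrib_left Suc_diff_le mult_ac)
  then have "(u + v)\<^sup>2 * (\<Sum>j = 1..Suc N. (- 1) ^ j * (2 * of_nat j - 1) * u ^ j * v ^ (Suc N + 1 - j))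
     = v * ((u + v)\<^sup>2 * (\<Sum>j = 1..N. (- 1) ^ j * (2 * of_nat j - 1) * u ^ j * v ^ (N + 1 - j)))
       + (u + v)\<^sup>2 * ((- 1) ^ Suc N * (2 * of_nat (Suc N) - 1) * u ^ Suc N * v)"
    by (simp only: distrib_left mult.left_commute)
  also have "\<dots> = u\<^sup>2 * v ^ (Suc N + 1) - u * v ^ (Suc N + 2)
    + (- 1) ^ Suc N * ((2 * of_nat (Suc N) + 1) * u ^ (Suc N + 1) * v\<^sup>2
        + (2 * of_nat (Suc N) - 1) * u ^ (Suc N + 2) * v)"
    unfolding Suc.IH by (simp add: power2_eq_square algebra_simps)
  finally show ?case .
qed

text \<open>The arguments stand for the squares of the two summation indices.\<close>

definition lattice_term :: "nat \<Rightarrow> real \<Rightarrow> real \<Rightarrow> real" where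
  "lattice_term N x y = (4 * real N / (x + y) + 2 * (1 + (- 1) ^ N) * (x - y) / (x + y)\<^sup>2) / x ^ N"

text \<open>A replacement for \<open>lattice_term\<close> with the same symmetrization. Each of its
  summands is a function of \<open>x\<close> times a function of \<open>y\<close>, so that its
  double sum splits into zeta values.\<close>

definition lattice_poly :: "nat \<Rightarrow> real \<Rightarrow> real \<Rightarrow> real" where
  "lattice_poly N x y =
     2 * (- 1) ^ N * (\<Sum>j = 1..N. (- 1) ^ j * (2 * real j - 1) * (1 / x ^ j) * (1 / y ^ (N + 1 - j)))"

text \<open>In the variables \<open>u = 1 / x\<close> and \<open>v = 1 / y\<close>, multiply by
  \<open>(u + v)^2\<close>. This clears the denominators of \<open>lattice_term\<close> and puts the
  sums in \<open>lattice_poly\<close> into closed form; what remains is a polynomial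
  identity.\<close>

lemma lattice_term_symmetrization:
  assumes "x > 0" "y > 0"
  shows "lattice_term N x y + lattice_term N y x = lattice_poly N x y + lattice_poly N y x"
proof -
  define u v where "u = 1 / x" and "v = 1 / y"
  have uv: "u > 0" "v > 0" using assms by (simp_all add: u_def v_def)
  have xy: "x = 1 / u" "y = 1 / v" by (simp_all add: u_def v_def)
  define e :: real where "e = (- 1) ^ N"
  have ee: "e * e = 1" by (simp add: e_def flip: power_mult_distrib)
  have nz: "(u + v)\<^sup>2 \<noteq> 0" using uv by simp
  define R where "R = (\<lambda>u v :: real. \<Sum>j = 1..N. (- 1) ^ j * (2 * real j - 1) * u ^ j * v ^ (N + 1 - j))"
  have P: "(u + v)\<^sup>2 * R u v = u\<^sup>2 * v ^ (N + 1) - u * v ^ (N + 2)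
    + e * ((2 * real N + 1) * u ^ (N + 1) * v\<^sup>2 + (2 * real N - 1) * u ^ (N + 2) * v)" for u v
    unfolding R_def e_def by (rule alternating_odd_weighted_sum_closed_form)
  have K: "(u + v)\<^sup>2 * lattice_term N (1 / u) (1 / v) =
     u * v * u ^ N * (4 * real N * (u + v) + 2 * (1 + e) * (v - u))" if "u > 0" "v > 0" for u v
  proof -
    have "1 / u + 1 / v = (u + v) / (u * v)" "1 / u - 1 / v = (v - u) / (u * v)"
      using that by (simp_all add: field_simps)
    then have "lattice_term N (1 / u) (1 / v) =
       (4 * real N * (u * v) / (u + v) + 2 * (1 + e) * (v - u) * (u * v) / (u + v)\<^sup>2) * u ^ N"
      using that by (simp add: lattice_term_def e_def power_divide power2_eq_square)
    moreover have "s\<^sup>2 * (a / s + b / s\<^sup>2) = a * s + b" if "s \<noteq> 0" for s a b :: real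
      using that by (simp add: field_simps power2_eq_square)
    from this[of "u + v"]
    have "(u + v)\<^sup>2 * (4 * real N * (u * v) / (u + v) + 2 * (1 + e) * (v - u) * (u * v) / (u + v)\<^sup>2)
      = 4 * real N * (u * v) * (u + v) + 2 * (1 + e) * (v - u) * (u * v)"
      using that by simp
    ultimately have "(u + v)\<^sup>2 * lattice_term N (1 / u) (1 / v) =
        (4 * real N * (u * v) * (u + v) + 2 * (1 + e) * (v - u) * (u * v)) * u ^ N"
      by (simp only: mult.assoc[symmetric])
    then show ?thesis by (simp add: algebra_simps)
  qed
  have KP: "lattice_poly N (1 / u) (1 / v) = 2 * e * R u v" for u v
    by (simp add: lattice_poly_def R_def e_def power_divide)
  have "(u + v)\<^sup>2 * (lattice_term N x y + lattice_term N y x)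
      = u * v * (4 * real N * (u + v) * (u ^ N + v ^ N) + 2 * (1 + e) * (v - u) * (u ^ N - v ^ N))"
    using K[OF uv] K[OF uv(2,1)] unfolding xy by (simp add: algebra_simps)
  \<comment> \<open>The factor \<open>e * e = 1\<close> is inserted so that a common
    \<open>e\<close> can be taken out and \<open>P\<close> recognized. The four terms after the
    first \<open>e\<close> cancel up to the contribution of \<open>2 * (1 + e)\<close> on the
    left.\<close>
  also have "\<dots> = 2 * (e * (u\<^sup>2 * v ^ (N + 1) - u * v ^ (N + 2) + v\<^sup>2 * u ^ (N + 1) - v * u ^ (N + 2)) + 
       (e * e) * ((2 * real N + 1) * u ^ (N + 1) * v\<^sup>2 + (2 * real N - 1) * u ^ (N + 2) * v
          + (2 * real N + 1) * v ^ (N + 1) * u\<^sup>2 + (2 * real N - 1) * v ^ (N + 2) * u))"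
    unfolding ee by (simp add: power2_eq_square algebra_simps)
  also have "\<dots> = 2 * e * ((u + v)\<^sup>2 * R u v) + 2 * e * ((v + u)\<^sup>2 * R v u)"
    unfolding P by (simp add: algebra_simps)
  also have "\<dots> = (u + v)\<^sup>2 * (lattice_poly N x y + lattice_poly N y x)"
    unfolding xy KP by (simp add: algebra_simps)
  finally show ?thesis using nz by simp
qed

section \<open>Absolute convergence, evaluation and rows of the double series\<close>

lemma has_sum_product:
  fixes a b :: "nat \<Rightarrow> real"
  assumes a: "a sums A" "\<And>n. a n \<ge> 0" and b: "b sums B" "\<And>n. b n \<ge> 0"
  shows "((\<lambda>(m, n). a m * b n) has_sum A * B) (UNIV \<times> UNIV)"
proof (rule has_sum_SigmaI)
  have a': "(a has_sum A) UNIV" and b': "(b has_sum B) UNIV"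
    using assms by (auto intro: sums_nonneg_imp_has_sum)
  show row: "((\<lambda>n. case (m, n) of (m, n) \<Rightarrow> a m * b n) has_sum a m * B) UNIV" for m
    using has_sum_cmult_right[OF b'] by simp
  show col: "((\<lambda>m. a m * B) has_sum A * B) UNIV"
    by (rule has_sum_cmult_left[OF a'])
  show "(\<lambda>(m, n). a m * b n) summable_on UNIV \<times> UNIV"
    using row has_sum_imp_summable[OF col]
    by (rule summable_on_SigmaI) (use assms in auto)
qed

abbreviation sq :: "nat \<Rightarrow> real" where "sq k \<equiv> real (Suc k) ^ 2"

text \<open>Since \<open>|x - y| \<le> x + y\<close>, the bracket in \<open>lattice_term\<close> is
  at most \<open>(4 * N + 4) / (x + y)\<close> in absolute value. With \<open>x \<ge> 1\<close> and
  \<open>N > 0\<close> this gives the bound \<open>(4 * N + 4) / (x * y)\<close>, a multiple of a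
  product of two convergent series.\<close>

lemma lattice_term_summable:
  assumes "N > 0"
  shows "(\<lambda>(k, m). lattice_term N (sq k) (sq m)) summable_on UNIV \<times> UNIV"
proof -
  have "(\<lambda>k. 1 / real (Suc k) ^ 2) sums zeta 2"
    using zeta_of_nat_sums[of 2] by simp
  then have "((\<lambda>(k, m). 1 / sq k * (1 / sq m)) has_sum zeta 2 * zeta 2) (UNIV \<times> UNIV)"
    by (intro has_sum_product) auto
  then have "(\<lambda>(k, m). 1 / sq k * (1 / sq m)) summable_on UNIV \<times> UNIV"
    by (rule has_sum_imp_summable)
  then have "(\<lambda>p. (4 * real N + 4) * (case p of (k, m) \<Rightarrow> 1 / sq k * (1 / sq m))) summable_on UNIV \<times> UNIV"
    by (rule summable_on_cmult_right)
  then have "(\<lambda>p. norm (case p of (k, m) \<Rightarrow> lattice_term N (sq k) (sq m))) summable_on UNIV \<times> UNIV"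
  proof (rule summable_on_comparison_test)
    fix p :: "nat \<times> nat"
    obtain k m where p: "p = (k, m)" by (cases p)
    define x y where "x = sq k" and "y = sq m"
    have x: "x \<ge> 1" and y: "y \<ge> 1" by (simp_all add: x_def y_def del: of_nat_Suc)
    have "\<bar>2 * (1 + (- 1) ^ N) * (x - y) / (x + y)\<^sup>2\<bar> = 2 * \<bar>1 + (- 1) ^ N\<bar> * (\<bar>x - y\<bar> / (x + y)\<^sup>2)"
      unfolding abs_divide abs_mult by simp
    also have "\<dots> \<le> 2 * 2 * ((x + y) / (x + y)\<^sup>2)"
      using x y by (intro mult_mono divide_right_mono) (auto simp: minus_one_power_iff)
    also have "\<dots> = 4 / (x + y)"
      using x y by (simp add: power2_eq_square)
    finally have "\<bar>4 * real N / (x + y) + 2 * (1 + (- 1) ^ N) * (x - y) / (x + y)\<^sup>2\<bar>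
        \<le> 4 * real N / (x + y) + 4 / (x + y)"
      using x y by (intro order.trans[OF abs_triangle_ineq] add_mono) auto
    also have "\<dots> = (4 * real N + 4) / (x + y)"
      by (simp add: add_divide_distrib)
    also have "\<dots> \<le> (4 * real N + 4) / y"
      using x y by (intro divide_left_mono) auto
    finally have *: "\<bar>4 * real N / (x + y) + 2 * (1 + (- 1) ^ N) * (x - y) / (x + y)\<^sup>2\<bar>
       \<le> (4 * real N + 4) / y" .
    have "norm (lattice_term N x y) = \<bar>4 * real N / (x + y) + 2 * (1 + (- 1) ^ N) * (x - y) / (x + y)\<^sup>2\<bar> / x ^ N"
      using x by (simp add: lattice_term_def)
    also have "\<dots> \<le> ((4 * real N + 4) / y) / x ^ 1"
      using x y assms * by (intro frac_le power_increasing) auto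
    finally show "norm (case p of (k, m) \<Rightarrow> lattice_term N (sq k) (sq m))
       \<le> (4 * real N + 4) * (case p of (k, m) \<Rightarrow> 1 / sq k * (1 / sq m))"
      by (simp add: p x_def y_def mult_ac)
  qed auto
  then show ?thesis by (rule abs_summable_summable)
qed

lemma has_sum_sum:
  fixes f :: "'i \<Rightarrow> 'a \<Rightarrow> 'b :: topological_comm_monoid_add"
  assumes "\<And>i. i \<in> I \<Longrightarrow> (f i has_sum S i) A"
  shows "((\<lambda>x. \<Sum>i\<in>I. f i x) has_sum (\<Sum>i\<in>I. S i)) A"
  using assms by (induction I rule: infinite_finite_induct) (auto intro: has_sum_add)

text \<open>Swapping the coordinates does not change an unconditional sum over a square, so the
  symmetrized families have sums \<open>S + S\<close> and \<open>T + T\<close>. It carries the value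
  of the sum of \<open>lattice_poly\<close> over to \<open>lattice_term\<close>.\<close>

lemma has_sum_eq_if_symmetrizations_eq:
  fixes f g :: "'a \<times> 'a \<Rightarrow> real"
  assumes f: "(f has_sum S) (A \<times> A)" and g: "(g has_sum T) (A \<times> A)"
    and eq: "\<And>x y. x \<in> A \<Longrightarrow> y \<in> A \<Longrightarrow> f (x, y) + f (y, x) = g (x, y) + g (y, x)"
  shows "S = T"
proof -
  have sym: "((\<lambda>p. h p + (case p of (x, y) \<Rightarrow> h (y, x))) has_sum R + R) (A \<times> A)"
    if "(h has_sum R) (A \<times> A)" for h :: "'a \<times> 'a \<Rightarrow> real" and R
    using that by (intro has_sum_add) (use has_sum_swap in blast)+
  have "((\<lambda>p. f p + (case p of (x, y) \<Rightarrow> f (y, x))) has_sum T + T) (A \<times> A)"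
    using sym[OF g] by (rule has_sum_cong[THEN iffD1, rotated]) (auto simp: eq)
  with sym[OF f] have "S + S = T + T" by (rule has_sum_unique)
  then show ?thesis by simp
qed

text \<open>For \<open>1 \<le> j \<le> N\<close> both exponents \<open>2 * j\<close> and
  \<open>2 * (N + 1 - j)\<close> are at least 2, so each summand is a product of two convergent zeta
  series.\<close>

lemma lattice_poly_has_sum:
  "((\<lambda>(k, m). lattice_poly N (sq k) (sq m)) has_sum
      2 * (- 1) ^ N * (\<Sum>j = 1..N. (- 1) ^ j * (2 * real j - 1)
         * zeta (real (2 * j)) * zeta (real (2 * (N + 1 - j))))) (UNIV \<times> UNIV)"
proof -
  have "((\<lambda>p. 2 * (- 1) ^ N * (\<Sum>j = 1..N. (- 1) ^ j * (2 * real j - 1) *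
        (case p of (k, m) \<Rightarrow> 1 / real (Suc k) ^ (2 * j) * (1 / real (Suc m) ^ (2 * (N + 1 - j))))))
     has_sum 2 * (- 1) ^ N * (\<Sum>j = 1..N. (- 1) ^ j * (2 * real j - 1)
         * (zeta (real (2 * j)) * zeta (real (2 * (N + 1 - j)))))) (UNIV \<times> UNIV)"
    by (intro has_sum_cmult_right has_sum_sum has_sum_product zeta_of_nat_sums) auto
  then show ?thesis
    by (simp add: lattice_poly_def case_prod_unfold mult.assoc flip: power_mult)
qed

lemma lattice_term_has_sum:
  assumes "N > 0"
  shows "((\<lambda>(k, m). lattice_term N (sq k) (sq m)) has_sum
      2 * (- 1) ^ N * (\<Sum>j = 1..N. (- 1) ^ j * (2 * real j - 1)
         * zeta (real (2 * j)) * zeta (real (2 * (N + 1 - j))))) (UNIV \<times> UNIV)"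
    (is "(?f has_sum ?Z) _")
proof -
  obtain S where S: "(?f has_sum S) (UNIV \<times> UNIV)"
    using lattice_term_summable[OF assms] by (auto simp: summable_on_def)
  have "S = ?Z"
    by (rule has_sum_eq_if_symmetrizations_eq[OF S lattice_poly_has_sum])
       (simp add: lattice_term_symmetrization del: of_nat_Suc)
  with S show ?thesis by simp
qed

text \<open>Combine the two hyperbolic partial fractions at \<open>x = k + 1\<close>, with factors
  \<open>2 * N / x\<close> and \<open>1 + (-1)^N\<close>. Their corrections \<open>- 1 / x\<close>
  and \<open>- 1 / x^2\<close> merge into the subtracted term.\<close>

lemma lattice_term_row_has_sum:
  assumes "N > 0"
  shows "((\<lambda>m. lattice_term N (sq k) (sq m)) has_sum
    pi * (2 * real N * (cosh (pi * real (Suc k)) / sinh (pi * real (Suc k))) / real (Suc k) ^ (2 * N + 1)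
       + (1 + (- 1) ^ N) * pi * (1 / real (Suc k) ^ (2 * N) / (sinh (pi * real (Suc k)))\<^sup>2))
    - (2 * real N + 1 + (- 1) ^ N) / real (Suc k) ^ (2 * N + 2)) UNIV"
    (is "(_ has_sum ?R) UNIV")
proof -
  define x where "x = real (Suc k)"
  have x: "x \<noteq> 0" by (simp add: x_def del: of_nat_Suc)
  define C where "C = cosh (pi * x) / sinh (pi * x)"
  define D where "D = pi\<^sup>2 / (sinh (pi * x))\<^sup>2"
  have "(\<lambda>m. (2 * real N / x * (2 * x / (x\<^sup>2 + sq m))
         + (1 + (- 1) ^ N) * (2 * (x\<^sup>2 - sq m) / (x\<^sup>2 + sq m)\<^sup>2)) / x ^ (2 * N)) sums
      ((2 * real N / x * (pi * C - 1 / x) + (1 + (- 1) ^ N) * (D - 1 / x\<^sup>2)) / x ^ (2 * N))"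
    unfolding C_def D_def
    by (intro sums_divide sums_add sums_mult coth_partial_fractions inverse_sinh_squared_partial_fractions x)
  also have "(\<lambda>m. (2 * real N / x * (2 * x / (x\<^sup>2 + sq m))
         + (1 + (- 1) ^ N) * (2 * (x\<^sup>2 - sq m) / (x\<^sup>2 + sq m)\<^sup>2)) / x ^ (2 * N)) =
     (\<lambda>m. lattice_term N (sq k) (sq m))"
    using x unfolding x_def[symmetric] lattice_term_def
    by (simp add: algebra_simps flip: power_mult)
  also have "(2 * real N / x * (pi * C - 1 / x) + (1 + (- 1) ^ N) * (D - 1 / x\<^sup>2)) / x ^ (2 * N) = ?R"
    unfolding x_def[symmetric] C_def[symmetric] D_def using x
    by (simp add: field_simps power2_eq_square)
  finally have "(\<lambda>m. lattice_term N (sq k) (sq m)) sums ?R" .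
  \<comment> \<open>The partial fractions give only ordered convergence; unconditional convergence
    of the row is inherited from the double series.\<close>
  have "(\<lambda>m. lattice_term N (sq k) (sq m)) summable_on UNIV"
    using lattice_term_summable[OF assms] by (rule summable_on_SigmaD1) simp
  then obtain S where S: "((\<lambda>m. lattice_term N (sq k) (sq m)) has_sum S) UNIV"
    by (auto simp: summable_on_def)
  have "S = ?R"
    using has_sum_imp_sums[OF S] \<open>_ sums ?R\<close> by (rule sums_unique2)
  with S show ?thesis by (simp only:)
qed

section \<open>The identity\<close>


text \<open>This splits the \<open>coth\<close> series into a zeta value (from the 1) and the
  exponential series of the theorem.\<close>

lemma coth_eq_exp:
  fixes x :: real
  assumes "x > 0"
  shows "cosh x / sinh x = 1 + 2 / (exp (2 * x) - 1)"
proof -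
  define E where "E = exp x"
  have E: "E > 1" using assms by (simp add: E_def)
  then have "E * E > 1 * 1" by (intro mult_strict_mono) auto
  moreover have "exp (2 * x) = E * E"
    unfolding E_def exp_add[symmetric] mult_2 ..
  moreover have "exp (- x) = 1 / E"
    by (simp add: E_def exp_minus inverse_eq_divide)
  moreover have "(E + 1 / E) / (E - 1 / E) = 1 + 2 / (E * E - 1)"
  proof -
    have "E + 1 / E = (E * E + 1) / E" "E - 1 / E = (E * E - 1) / E"
      using E by (simp_all add: field_simps)
    then have "(E + 1 / E) / (E - 1 / E) = (E * E + 1) / (E * E - 1)"
      using E by simp
    then show ?thesis using \<open>E * E > 1 * 1\<close> by (simp add: field_simps)
  qed
  moreover have "cosh x / sinh x = (exp x + exp (- x)) / (exp x - exp (- x))"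
    unfolding cosh_def sinh_def real_scaleR_def by (rule mult_divide_mult_cancel_left) simp
  ultimately show ?thesis
    by (simp only: E_def[symmetric])
qed

text \<open>The extra factor \<open>pi\<close> completes the power to \<open>P / 2\<close> with
  \<open>P = (2 * pi)^(2 * N + 2)\<close>. The end terms \<open>j = 0\<close> and
  \<open>j = N + 1\<close> contain \<open>bernoulli 0 = 1\<close> and give the multiple of
  \<open>zeta (2 * N + 2)\<close>; in the others, Euler's formula applies to both factors.\<close>

lemma bernoulli_product_sum_eq_zeta:
  "pi * ((2 * pi) ^ (2 * N + 1) *
         (\<Sum>j = 0..N + 1. (- 1) ^ (j + 1) * (2 * real j - 1)
            * (bernoulli (2 * j) / fact (2 * j))
            * (bernoulli (2 * N + 2 - 2 * j) / fact (2 * N + 2 - 2 * j)))) =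
     (2 * real N + 1 + (- 1) ^ N) * zeta (real (2 * N + 2)) +
     2 * (- 1) ^ N * (\<Sum>j = 1..N. (- 1) ^ j * (2 * real j - 1)
         * zeta (real (2 * j)) * zeta (real (2 * (N + 1 - j))))"
proof -
  define P where "P = (2 * pi) ^ (2 * N + 2)"
  have P: "P \<noteq> 0" by (simp add: P_def)
  define e :: real where "e = (- 1) ^ N"
  have ee: "e * e = 1" by (simp add: e_def flip: power_mult_distrib)
  define b where "b = (\<lambda>j. bernoulli (2 * j) / fact (2 * j))"
  define t where "t = (\<lambda>j. (- 1) ^ (j + 1) * (2 * real j - 1) * b j * b (N + 1 - j))"
  have b0: "b 0 = 1" by (simp add: b_def bernoulli_0)
  have bN: "b (N + 1) = 2 * e * zeta (real (2 * N + 2)) / P"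
    using bernoulli_even_eq_zeta[of "N + 1"] by (simp add: b_def e_def P_def)
  have mid: "P / 2 * t j = 2 * e * ((- 1) ^ j * (2 * real j - 1)
         * zeta (real (2 * j)) * zeta (real (2 * (N + 1 - j))))" if j: "j \<in> {1..N}" for j
  proof -
    define i where "i = N + 1 - j"
    have i: "i > 0" "i + j = N + 1" using j by (auto simp: i_def)
    have "(2 * pi) ^ (2 * j) * (2 * pi) ^ (2 * i) = P"
    proof -
      have "2 * j + 2 * i = 2 * N + 2" using i(2) by simp
      then show ?thesis unfolding P_def power_add[symmetric] by (simp only:)
    qed
    then have "b j * b i = 4 * ((- 1) ^ (j + 1) * (- 1) ^ (i + 1)) * zeta (real (2 * j)) * zeta (real (2 * i)) / P"
      unfolding b_def using bernoulli_even_eq_zeta[of j] bernoulli_even_eq_zeta[of i] i(1) j by simp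
    \<comment> \<open>The two Euler signs multiply to \<open>(-1)^(i + j)\<close> with
      \<open>i + j = N + 1\<close>, independently of \<open>j\<close>.\<close>
    also have "(- 1 :: real) ^ (j + 1) * (- 1) ^ (i + 1) = - e"
    proof -
      have "(- 1 :: real) ^ (j + 1) * (- 1) ^ (i + 1) = (- 1) ^ (i + j)"
        by (simp add: power_add mult_ac)
      then show ?thesis by (simp add: i(2) e_def)
    qed
    finally show ?thesis
      using P unfolding t_def i_def[symmetric] by (simp add: mult.assoc)
  qed
  have "pi * ((2 * pi) ^ (2 * N + 1) *
         (\<Sum>j = 0..N + 1. (- 1) ^ (j + 1) * (2 * real j - 1)
            * (bernoulli (2 * j) / fact (2 * j))
            * (bernoulli (2 * N + 2 - 2 * j) / fact (2 * N + 2 - 2 * j)))) =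
        P / 2 * (\<Sum>j = 0..N + 1. t j)"
  proof -
    have "2 * N + 2 - 2 * j = 2 * (N + 1 - j)" for j by simp
    then show ?thesis unfolding t_def b_def P_def by simp
  qed
  also have "(\<Sum>j = 0..N + 1. t j) = t 0 + (\<Sum>j = 1..N. t j) + t (N + 1)"
    by (simp add: sum.atLeast_Suc_atMost)
  also have "P / 2 * \<dots> = P / 2 * t 0 + (\<Sum>j = 1..N. P / 2 * t j) + P / 2 * t (N + 1)"
    by (simp only: distrib_left sum_distrib_left)
  also have "P / 2 * t 0 = e * zeta (real (2 * N + 2))"
    using P by (simp add: t_def b0 bN[simplified])
  also have "P / 2 * t (N + 1) = (e * e) * ((2 * real N + 1) * zeta (real (2 * N + 2)))"
    unfolding t_def bN using P by (simp add: b0 mult_ac add_ac flip: e_def)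
  also have "(\<Sum>j = 1..N. P / 2 * t j) = 2 * e * (\<Sum>j = 1..N. (- 1) ^ j * (2 * real j - 1)
         * zeta (real (2 * j)) * zeta (real (2 * (N + 1 - j))))"
    unfolding sum_distrib_left by (intro sum.cong refl mid)
  finally show ?thesis unfolding ee e_def by (simp add: algebra_simps)
qed

theorem mainTheorem3:
  fixes N :: nat
  assumes "N > 0"
  shows "2 * real N * zeta (2 * real N + 1)
       + 4 * real N *
           (\<Sum>k. (1 / real (Suc k) ^ (2 * N + 1)) / (exp (2 * pi * real (Suc k)) - 1))
       + (1 + (- 1) ^ N) * pi *
           (\<Sum>k. (1 / real (Suc k) ^ (2 * N)) / (sinh (pi * real (Suc k)))\<^sup>2)
     = (2 * pi) ^ (2 * N + 1) *
         (\<Sum>j = 0..N + 1. (- 1) ^ (j + 1) * (2 * real j - 1)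
            * (bernoulli (2 * j) / fact (2 * j))
            * (bernoulli (2 * N + 2 - 2 * j) / fact (2 * N + 2 - 2 * j)))"
    (is "?L = ?R")
proof -
  define E where "E = (\<lambda>k. (1 / real (Suc k) ^ (2 * N + 1)) / (exp (2 * pi * real (Suc k)) - 1))"
  define H where "H = (\<lambda>k. (1 / real (Suc k) ^ (2 * N)) / (sinh (pi * real (Suc k)))\<^sup>2)"
  define C where "C = (\<lambda>k. cosh (pi * real (Suc k)) / sinh (pi * real (Suc k)))"
  define Z where "Z = 2 * (- 1) ^ N * (\<Sum>j = 1..N. (- 1) ^ j * (2 * real j - 1)
         * zeta (real (2 * j)) * zeta (real (2 * (N + 1 - j))))"
  \<comment> \<open>The value of the inner sum over \<open>m\<close>, by
    \<open>lattice_term_row_has_sum\<close>.\<close>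
  define row where "row = (\<lambda>k. pi * (2 * real N * C k / real (Suc k) ^ (2 * N + 1)
      + (1 + (- 1) ^ N) * pi * H k) - (2 * real N + 1 + (- 1) ^ N) / real (Suc k) ^ (2 * N + 2))"
  have "(row has_sum Z) UNIV"
    using lattice_term_has_sum[OF assms] unfolding Z_def row_def C_def H_def
    by (rule has_sum_SigmaD) (use lattice_term_row_has_sum[OF assms] in \<open>simp del: of_nat_Suc\<close>)
  then have "row sums Z" by (rule has_sum_imp_sums)
  moreover have "(\<lambda>k. 1 / real (Suc k) ^ (2 * N + 2)) sums zeta (real (2 * N + 2))"
    by (rule zeta_of_nat_sums) simp
  ultimately have S1: "(\<lambda>k. (2 * real N + 1 + (- 1) ^ N) * (1 / real (Suc k) ^ (2 * N + 2)) + row k)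
      sums ((2 * real N + 1 + (- 1) ^ N) * zeta (real (2 * N + 2)) + Z)"
    by (intro sums_add sums_mult)
  have "(\<lambda>k. 1 / real (Suc k) ^ (2 * N + 1)) sums zeta (real (2 * N + 1))"
    using assms by (intro zeta_of_nat_sums) simp
  moreover have "E sums suminf E" "H sums suminf H"
    unfolding E_def H_def
    by (intro summable_sums summable_exp_series summable_sinh_series assms)+
  ultimately have S2: "(\<lambda>k. pi * (2 * real N * (1 / real (Suc k) ^ (2 * N + 1)) + 4 * real N * E k
        + (1 + (- 1) ^ N) * pi * H k))
      sums (pi * (2 * real N * zeta (real (2 * N + 1)) + 4 * real N * suminf E
        + (1 + (- 1) ^ N) * pi * suminf H))"
    by (intro sums_add sums_mult)
  \<comment> \<open>The added term cancels the correction in \<open>row\<close>, and splitting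
    \<open>coth\<close> shows that \<open>S1\<close> and \<open>S2\<close> sum the same
    sequence.\<close>
  have "(2 * real N + 1 + (- 1) ^ N) * (1 / real (Suc k) ^ (2 * N + 2)) + row k =
      pi * (2 * real N * (1 / real (Suc k) ^ (2 * N + 1)) + 4 * real N * E k
        + (1 + (- 1) ^ N) * pi * H k)" for k
  proof -
    have "C k = 1 + 2 / (exp (2 * pi * real (Suc k)) - 1)"
      unfolding C_def by (subst coth_eq_exp) (simp_all add: mult.assoc)
    then have "2 * real N * C k / real (Suc k) ^ (2 * N + 1)
        = 2 * real N * (1 / real (Suc k) ^ (2 * N + 1)) + 4 * real N * E k"
      unfolding E_def by (simp add: ring_distribs add_divide_distrib mult_ac)
    then show ?thesis unfolding row_def by simp
  qed
  with S1 S2 have "pi * (2 * real N * zeta (real (2 * N + 1)) + 4 * real N * suminf E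
        + (1 + (- 1) ^ N) * pi * suminf H)
      = (2 * real N + 1 + (- 1) ^ N) * zeta (real (2 * N + 2)) + Z"
    by (simp only: sums_unique2)
  also have "\<dots> = pi * ?R"
    unfolding Z_def by (rule bernoulli_product_sum_eq_zeta[symmetric])
  finally have "2 * real N * zeta (real (2 * N + 1)) + 4 * real N * suminf E
        + (1 + (- 1) ^ N) * pi * suminf H = ?R"
    by simp
  then show ?thesis by (simp add: E_def H_def add.commute)
qed

end
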